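(* Let $\omega$ be a majorant for which there are constants $\delta_0>0$ and $C>0$ with $$\int_{0}^{\delta}\frac{\omega(t)}{t}\,dt\leq C\omega(\delta),\qquad 0<\delta<\delta_{0},$$ and let $G\subset\mathbb{C}^n$ be a $\Lambda_{\omega}$-extension domain. Let $k\in(0,1)$. If $f\in\mathcal{H}_{k}(G)$ and $f$ is continuous up to the boundary $\partial G$, then $$f\in\Lambda_{\omega}(G)\Longleftrightarrow |f|\in\Lambda_{\omega}(G)\Longleftrightarrow |f|\in\Lambda_{\omega}(G,\partial G).$$
   Context: For $z,w\in\mathbb{C}^n$, $z\cdot w=\sum_{j=1}^n z_j\overline{w}_j$, $|z|=(z\cdot z)^{1/2}$, $\mathbb{B}^n=\{z\in\mathbb{C}^n:|z|<1\}$; $d_G(z)$ is the distance from $z$ to $\partial G$. A continuous complex-valued function $f$ on a domain $G\subset\mathbb{C}^n$ is pluriharmonic if for each $z\in G$ and $\theta\in\partial\mathbb{B}^n$ the function $\zeta\mapsto f(z+\theta\zeta)$ is harmonic in $\{\zeta\in\mathbb{C}:|\zeta|<d_G(z)\}$. Notation: $\nabla f=(f_{z_1},\dots,f_{z_n})$ and $\nabla\overline f=(f_{\overline z_1},\dots,f_{\overline z_n})$. For a proper domain $G$ of $\mathbb{C}^n$ and $k\in(0,1)$, $\mathcal{H}_k(G)$ is the class of all pluriharmonic mappings $f=h+\overline g$ from $G$ into $\mathbb{C}$, with $h,g$ holomorphic in $G$, such that for every $\theta\in\partial\mathbb{B}^n$ and $z\in G$, $|\nabla\overline f(z)\cdot\theta|\le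 k\,|\nabla f(z)\cdot\overline\theta|$. A majorant is a continuous increasing function $\omega:[0,\infty)\to[0,\infty)$ with $\omega(0)=0$ such that $\omega(t)/t$ is non-increasing for $t>0$. $\Lambda_\omega(G)$: functions $f:G\to\mathbb{C}$ for which there is a constant $C>0$ with $|f(z)-f(w)|\le C\omega(|z-w|)$ for all $z,w\in G$. $\mathrm{loc}\Lambda_\omega(G)$ ($G$ a proper subdomain of $\mathbb{C}^n$): functions $f:G\to\mathbb{C}$ for which there is $C>0$ such that this inequality holds for all $z,w\in G$ with $|z-w|<\frac12 d_G(z)$. $\Lambda_\omega(G,\partial G)$: continuous functions $f$ on $G\cup\partial G$ for which there is $C>0$ such that $|f(z)-f(w)|\le C\omega(|z-w|)$ whenever $z\in G$ and $w\in\partial G$. $G$ is a $\Lambda_\omega$-extension domain if it is a proper subdomain of $\mathbb{C}^n$ and $\Lambda_\omega(G)=\mathrm{loc}\Lambda_\omega(G)$. By a known theorem of Lappalainen, this holds if and only if there is a constant $C=C(G,\omega)>0$ such that each pair of points $z,w\in G$ can be joined by a rectifiable curve $\gamma\subset G$ with $\int_\gamma\frac{\omega(d_G(\zeta))}{d_G(\zeta)}\,ds(\zeta)\le C\omega(|z-w|)$, where $ds$ is arclength. *)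

theory Defs
  imports "HOL-Analysis.Analysis"
begin

text \<open>The space \<open>\<complex>\<^sup>n\<close> is \<open>complex ^ 'n\<close>, whose library norm is the Euclidean one
  (lemma \<open>norm_eq_sqrt_hdot\<close> below).  A function on a set \<open>G\<close> is a total function of which only
  the values on \<open>G\<close> (or on \<open>G \<union> frontier G\<close>) matter.\<close>

definition hdot :: "complex ^ 'n \<Rightarrow> complex ^ 'n \<Rightarrow> complex" where
  "hdot z w = (\<Sum>j\<in>UNIV. z $ j * cnj (w $ j))"

lemma norm_eq_sqrt_hdot: "complex_of_real (norm z) = csqrt (hdot z z)"
proof -
  have "hdot z z = of_real ((norm z)\<^sup>2)"
    by (simp add: hdot_def norm_vec_def L2_set_def sum_nonneg complex_norm_square del: of_real_power)
  then show ?thesis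
    by (simp add: csqrt_unique)
qed

definition vcnj :: "complex ^ 'n \<Rightarrow> complex ^ 'n" where
  "vcnj z = (\<chi> j. cnj (z $ j))"

definition domain :: "(complex ^ 'n) set \<Rightarrow> bool" where
  "domain G \<longleftrightarrow> open G \<and> connected G \<and> G \<noteq> {}"

definition proper_domain :: "(complex ^ 'n) set \<Rightarrow> bool" where
  "proper_domain G \<longleftrightarrow> domain G \<and> G \<noteq> UNIV"

text \<open>Since \<open>infdist x {} = 0\<close>, this is meaningful only when \<open>frontier G\<close> is nonempty, which holds
  for proper domains.\<close>

definition bdist :: "(complex ^ 'n) set \<Rightarrow> complex ^ 'n \<Rightarrow> real" where
  "bdist G z = infdist z (frontier G)"

text \<open>Harmonic on an open subset of the plane: of class \<open>C\<^sup>2\<close> in the real sense with vanishing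
  Laplacian.  Below, \<open>ux\<close> and \<open>uy\<close> are the first partial derivatives of \<open>u\<close>, and
  \<open>uxx\<close>, \<open>uxy\<close>, \<open>uyx\<close>, \<open>uyy\<close> the second ones.\<close>

definition harmonic_on :: "(complex \<Rightarrow> complex) \<Rightarrow> complex set \<Rightarrow> bool" where
  "harmonic_on u S \<longleftrightarrow> (\<exists>ux uy uxx uxy uyx uyy :: complex \<Rightarrow> complex.
     (\<forall>z\<in>S. (u has_derivative (\<lambda>v. Re v *\<^sub>R ux z + Im v *\<^sub>R uy z)) (at z)) \<and>
     (\<forall>z\<in>S. (ux has_derivative (\<lambda>v. Re v *\<^sub>R uxx z + Im v *\<^sub>R uxy z)) (at z)) \<and>
     (\<forall>z\<in>S. (uy has_derivative (\<lambda>v. Re v *\<^sub>R uyx z + Im v *\<^sub>R uyy z)) (at z)) \<and>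
     continuous_on S uxx \<and> continuous_on S uxy \<and> continuous_on S uyx \<and> continuous_on S uyy \<and>
     (\<forall>z\<in>S. uxx z + uyy z = 0))"

definition pluriharmonic_on :: "(complex ^ 'n \<Rightarrow> complex) \<Rightarrow> (complex ^ 'n) set \<Rightarrow> bool" where
  "pluriharmonic_on f G \<longleftrightarrow> continuous_on G f \<and>
     (\<forall>z\<in>G. \<forall>\<theta>. norm \<theta> = 1 \<longrightarrow>
        harmonic_on (\<lambda>\<zeta>. f (z + \<zeta> *s \<theta>)) {\<zeta>. norm \<zeta> < bdist G z})"

text \<open>Holomorphic in several variables: the real Frechet derivative exists and is
  complex linear.\<close>

definition holomorphic_vec_on :: "(complex ^ 'n \<Rightarrow> complex) \<Rightarrow> (complex ^ 'n) set \<Rightarrow> bool" where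
  "holomorphic_vec_on h G \<longleftrightarrow>
     (\<forall>z\<in>G. \<exists>D. (h has_derivative D) (at z) \<and> (\<forall>c v. D (c *s v) = c * D v))"

text \<open>Gradients of Wirtinger derivatives, \<open>(f\<^sub>x - \<i> f\<^sub>y) / 2\<close> and \<open>(f\<^sub>x + \<i> f\<^sub>y) / 2\<close> in each
  coordinate \<open>x + \<i> y\<close>; the real directions are \<open>axis j 1\<close> and \<open>axis j \<i>\<close>.  The vector denoted by
  nabla of f-bar is \<open>grad_zbar f\<close>: it consists of the derivatives of \<open>f\<close> itself, not of its
  conjugate, with respect to the conjugate variables.\<close>

definition grad_z :: "(complex ^ 'n \<Rightarrow> complex) \<Rightarrow> complex ^ 'n \<Rightarrow> complex ^ 'n" where
  "grad_z f z = (\<chi> j. (frechet_derivative f (at z) (axis j 1)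
                     - \<i> * frechet_derivative f (at z) (axis j \<i>)) / 2)"

definition grad_zbar :: "(complex ^ 'n \<Rightarrow> complex) \<Rightarrow> complex ^ 'n \<Rightarrow> complex ^ 'n" where
  "grad_zbar f z = (\<chi> j. (frechet_derivative f (at z) (axis j 1)
                        + \<i> * frechet_derivative f (at z) (axis j \<i>)) / 2)"

definition Hk :: "real \<Rightarrow> (complex ^ 'n) set \<Rightarrow> (complex ^ 'n \<Rightarrow> complex) set" where
  "Hk k G = {f. pluriharmonic_on f G \<and>
     (\<exists>h g. holomorphic_vec_on h G \<and> holomorphic_vec_on g G \<and> (\<forall>z\<in>G. f z = h z + cnj (g z))) \<and>
     (\<forall>\<theta>. norm \<theta> = 1 \<longrightarrow> (\<forall>z\<in>G.
        norm (hdot (grad_zbar f z) \<theta>) \<le> k * norm (hdot (grad_z f z) (vcnj \<theta>))))}"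

text \<open>``Increasing'' is read as nondecreasing, which includes the strictly increasing case.\<close>

definition majorant :: "(real \<Rightarrow> real) \<Rightarrow> bool" where
  "majorant \<omega> \<longleftrightarrow> continuous_on {0..} \<omega> \<and> mono_on {0..} \<omega> \<and> (\<forall>t\<ge>0. \<omega> t \<ge> 0) \<and> \<omega> 0 = 0 \<and>
     antimono_on {0<..} (\<lambda>t. \<omega> t / t)"

definition Lip :: "(real \<Rightarrow> real) \<Rightarrow> (complex ^ 'n) set \<Rightarrow> (complex ^ 'n \<Rightarrow> complex) set" where
  "Lip \<omega> G = {f. \<exists>C>0. \<forall>z\<in>G. \<forall>w\<in>G. norm (f z - f w) \<le> C * \<omega> (norm (z - w))}"

definition loc_Lip :: "(real \<Rightarrow> real) \<Rightarrow> (complex ^ 'n) set \<Rightarrow> (complex ^ 'n \<Rightarrow> complex) set" where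
  "loc_Lip \<omega> G = {f. \<exists>C>0. \<forall>z\<in>G. \<forall>w\<in>G.
     norm (z - w) < bdist G z / 2 \<longrightarrow> norm (f z - f w) \<le> C * \<omega> (norm (z - w))}"

definition bdry_Lip :: "(real \<Rightarrow> real) \<Rightarrow> (complex ^ 'n) set \<Rightarrow> (complex ^ 'n \<Rightarrow> complex) set" where
  "bdry_Lip \<omega> G = {f. continuous_on (G \<union> frontier G) f \<and>
     (\<exists>C>0. \<forall>z\<in>G. \<forall>w\<in>frontier G. norm (f z - f w) \<le> C * \<omega> (norm (z - w)))}"

definition extension_domain :: "(real \<Rightarrow> real) \<Rightarrow> (complex ^ 'n) set \<Rightarrow> bool" where
  "extension_domain \<omega> G \<longleftrightarrow> proper_domain G \<and> Lip \<omega> G = loc_Lip \<omega> G"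

end

theory Submission
  imports Defs "HOL-Complex_Analysis.Conformal_Mappings"
begin

text \<open>The implications from \<open>f\<close> to \<open>|f|\<close> and from \<open>G\<close> to its boundary are the reverse triangle
  inequality and a passage to the limit.  The substance is the way back: a modulus of continuity
  of \<open>|f|\<close> between interior and boundary points controls \<open>f\<close> itself.

  Fix \<open>z \<in> G\<close>, let \<open>d\<close> be its distance to the boundary and \<open>\<zeta>\<close> a nearest boundary point.
  Comparing through \<open>\<zeta>\<close>, the function \<open>|f|\<close> exceeds \<open>|f(z)|\<close> by at most a multiple of \<open>\<omega>(d)\<close> on the
  ball of radius \<open>d\<close> about \<open>z\<close>.  On every complex line through \<open>z\<close> the map is
  \<open>F = H + cnj K\<close>, with \<open>H\<close> and \<open>K\<close> holomorphic and \<open>|K'| \<le> k |H'|\<close>.  After rotating so that \<open>F(0) = |F(0)|\<close>, the real part of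
  \<open>M - F\<close> is a positive harmonic function as soon as \<open>|F| < M\<close>, with value \<open>M - |F(0)|\<close> at the
  centre, so on a disc of radius \<open>d\<close> its gradient there is at most \<open>2 / d\<close> times that value
  (lemma \<open>norm_deriv_le_if_Re_pos\<close>, for the unit disc).
  This gradient has norm \<open>|H'(0) + K'(0)|\<close>, which the distortion condition bounds
  below by \<open>(1 - k) |H'(0)|\<close> (lemma \<open>harmonic_quasiregular_deriv_bound\<close>).  Thus the
  derivative of \<open>f\<close> at \<open>z\<close> is at most a multiple of \<open>\<omega>(d) / d\<close>.

  Since \<open>\<omega>(t) / t\<close> is non-increasing, the mean value inequality on a segment that stays at distance
  at least \<open>d / 2\<close> from the boundary gives the local Lipschitz condition
  (lemma \<open>loc_Lip_if_derivative_bound\<close>), and the defining property of an extension domain turns it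
  into the global one.\<close>

section \<open>The derivative at the centre of a disc\<close>

text \<open>This is the Schwarz lemma for the Cayley transform that sends the right half plane to the
  unit disc and \<open>P 0\<close> to the origin; the derivative of the composition at the origin is
  \<open>P'(0) / (2 Re P(0))\<close>.\<close>

lemma norm_deriv_le_if_Re_pos:
  fixes P :: "complex \<Rightarrow> complex"
  assumes hol: "P holomorphic_on ball 0 1" and pos: "\<And>z. norm z < 1 \<Longrightarrow> 0 < Re (P z)"
  shows "norm (deriv P 0) \<le> 2 * Re (P 0)"
proof -
  define p where "p = P 0"
  define \<phi> where "\<phi> = (\<lambda>z. (P z - p) / (P z + cnj p))"
  have p: "0 < Re p"
    using pos[of 0] by (simp add: p_def)
  have nz: "P z + cnj p \<noteq> 0" if "norm z < 1" for z
  proof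
    assume "P z + cnj p = 0"
    then have "Re (P z + cnj p) = 0"
      by simp
    with pos[OF that] p show False
      by simp
  qed
  have "\<phi> holomorphic_on ball 0 1"
    unfolding \<phi>_def using nz by (intro holomorphic_intros hol) auto
  moreover have "norm (\<phi> z) < 1" if "norm z < 1" for z
  proof -
    have "0 < Re (P z) * Re p"
      using pos[OF that] p by simp
    then have "(norm (P z - p))\<^sup>2 < (norm (P z + cnj p))\<^sup>2"
      unfolding cmod_power2 by (simp add: power2_eq_square algebra_simps)
    then have "norm (P z - p) < norm (P z + cnj p)"
      by (rule power2_less_imp_less) simp
    then show ?thesis
      using nz[OF that] by (simp add: \<phi>_def norm_divide)
  qed
  ultimately have "norm (deriv \<phi> 0) \<le> 1"
    by (intro Schwarz_Lemma(2)[where \<xi> = 0]) (auto simp: \<phi>_def p_def)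
  moreover have "deriv \<phi> 0 = deriv P 0 / (2 * of_real (Re p))"
  proof (rule DERIV_imp_deriv)
    have P': "(P has_field_derivative deriv P 0) (at 0)"
      by (rule holomorphic_derivI[OF hol]) auto
    have sum: "P 0 + cnj p = 2 * of_real (Re p)"
      by (simp add: p_def complex_eq_iff)
    have "(\<phi> has_field_derivative
        (deriv P 0 * (P 0 + cnj p) - (P 0 - p) * deriv P 0) / ((P 0 + cnj p) * (P 0 + cnj p))) (at 0)"
      unfolding \<phi>_def using nz[of 0] by (auto intro!: derivative_eq_intros P')
    then show "(\<phi> has_field_derivative deriv P 0 / (2 * of_real (Re p))) (at 0)"
      using p unfolding sum by (simp add: p_def)
  qed
  ultimately show ?thesis
    using p by (simp add: norm_divide norm_mult p_def)
qed

text \<open>Rotating by a unimodular \<open>a\<close> makes the value at the centre real, so that the loss in replacing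
  \<open>|F|\<close> by the real part of \<open>cnj a * F\<close> vanishes at the centre.  That real part is also the real
  part of the holomorphic function \<open>cnj a * H + a * G\<close>, to which the half-plane estimate
  applies.\<close>

lemma harmonic_quasiregular_deriv_bound:
  fixes H G :: "complex \<Rightarrow> complex"
  assumes H: "H holomorphic_on ball 0 1" and G: "G holomorphic_on ball 0 1"
    and dist: "norm (deriv G 0) \<le> k * norm (deriv H 0)"
    and bound: "\<And>z. norm z < 1 \<Longrightarrow> norm (H z + cnj (G z)) \<le> M"
  shows "(1 - k) * norm (deriv H 0) \<le> 2 * (M - norm (H 0 + cnj (G 0)))"
proof -
  define F0 where "F0 = H 0 + cnj (G 0)"
  define a where "a = cis (Arg F0)"
  have a: "norm a = 1" "cnj a * F0 = of_real (norm F0)"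
  proof -
    have "F0 = of_real (norm F0) * a"
      using rcis_cmod_Arg[of F0] by (simp add: a_def rcis_def)
    moreover have "cnj a * a = 1"
      by (simp add: a_def cis_cnj cis_mult)
    ultimately show "cnj a * F0 = of_real (norm F0)"
      by (metis mult.left_commute mult.right_neutral)
  qed (simp add: a_def)
  have Re_eq: "Re (cnj a * H z + a * G z) = Re (cnj a * (H z + cnj (G z)))" for z
    by (simp add: algebra_simps)
  have "(1 - k) * norm (deriv H 0) \<le> 2 * (M - norm F0) + e" if "e > 0" for e
  proof -
    \<comment> \<open>The slack \<open>e / 2\<close> makes the real part strictly positive, since \<open>|F|\<close> may attain \<open>M\<close>.\<close>
    define P where "P = (\<lambda>z. of_real (M + e / 2) - (cnj a * H z + a * G z))"
    have "P holomorphic_on ball 0 1"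
      unfolding P_def by (intro holomorphic_intros H G)
    moreover have "0 < Re (P z)" if "norm z < 1" for z
    proof -
      have "Re (cnj a * H z + a * G z) \<le> norm (cnj a * (H z + cnj (G z)))"
        unfolding Re_eq by (rule complex_Re_le_cmod)
      also have "\<dots> \<le> M"
        using bound[OF that] a by (simp add: norm_mult)
      finally show ?thesis
        using \<open>e > 0\<close> by (simp add: P_def)
    qed
    ultimately have "norm (deriv P 0) \<le> 2 * Re (P 0)"
      by (rule norm_deriv_le_if_Re_pos)
    moreover have "Re (P 0) = M - norm F0 + e / 2"
      using a(2) Re_eq[of 0] by (simp add: P_def F0_def[symmetric])
    moreover have "deriv P 0 = - (cnj a * deriv H 0 + a * deriv G 0)"
      unfolding P_def
      by (rule DERIV_imp_deriv)
        (auto intro!: derivative_eq_intros holomorphic_derivI[OF H] holomorphic_derivI[OF G])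
    moreover have "norm (deriv H 0) - norm (deriv G 0) \<le> norm (cnj a * deriv H 0 + a * deriv G 0)"
      using norm_diff_ineq[of "cnj a * deriv H 0" "a * deriv G 0"] a(1) by (simp add: norm_mult)
    ultimately have "norm (deriv H 0) - norm (deriv G 0) \<le> 2 * (M - norm F0) + e"
      by (simp del: minus_add_distrib)
    then show ?thesis
      using dist by (simp add: algebra_simps)
  qed
  then show ?thesis
    unfolding F0_def by (rule field_le_epsilon)
qed

section \<open>Complex directions and slices\<close>

lemma complex_homogeneous_expansion:
  fixes D :: "complex ^ 'n \<Rightarrow> complex"
  assumes "linear D" and "\<And>c v. D (c *s v) = c * D v"
  shows "D v = (\<Sum>j\<in>UNIV. v $ j * D (axis j 1))"
proof -
  have "D v = D (\<Sum>j\<in>UNIV. (v $ j) *s axis j 1)"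
    by (simp add: basis_expansion)
  also have "\<dots> = (\<Sum>j\<in>UNIV. v $ j * D (axis j 1))"
    using assms by (simp add: linear_sum)
  finally show ?thesis .
qed

text \<open>With \<open>Df = A + cnj \<circ> B\<close> for complex-linear \<open>A\<close> and \<open>B\<close>, the two gradients have the components
  \<open>A e\<^sub>j\<close> and \<open>cnj (B e\<^sub>j)\<close>, so the distortion condition compares \<open>B\<close> with \<open>A\<close> in
  the direction \<open>\<theta>\<close>.\<close>

lemma hdot_gradients:
  fixes A B :: "complex ^ 'n \<Rightarrow> complex"
  assumes f: "(f has_derivative (\<lambda>v. A v + cnj (B v))) (at z)"
    and A: "linear A" "\<And>c v. A (c *s v) = c * A v"
    and B: "linear B" "\<And>c v. B (c *s v) = c * B v"
  shows "hdot (grad_z f z) (vcnj \<theta>) = A \<theta>" and "hdot (grad_zbar f z) \<theta> = cnj (B \<theta>)"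
proof -
  have fd: "frechet_derivative f (at z) = (\<lambda>v. A v + cnj (B v))"
    using frechet_derivative_at[OF f] by simp
  have "axis j \<i> = \<i> *s (axis j 1 :: complex ^ 'n)" for j
    by (simp add: vec_eq_iff axis_def)
  then have ax: "A (axis j \<i>) = \<i> * A (axis j 1)" "B (axis j \<i>) = \<i> * B (axis j 1)" for j
    using A(2) B(2) by simp_all
  have i_sq: "\<i> * (\<i> * c) = - c" for c
    by (simp add: mult.assoc[symmetric])
  have "grad_z f z = (\<chi> j. A (axis j 1))" "grad_zbar f z = (\<chi> j. cnj (B (axis j 1)))"
    by (simp_all add: grad_z_def grad_zbar_def fd ax vec_eq_iff algebra_simps i_sq)
  then show "hdot (grad_z f z) (vcnj \<theta>) = A \<theta>" "hdot (grad_zbar f z) \<theta> = cnj (B \<theta>)"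
    by (simp_all add: hdot_def vcnj_def complex_homogeneous_expansion[OF A, of \<theta>]
        complex_homogeneous_expansion[OF B, of \<theta>] mult.commute)
qed

lemma slice_has_field_derivative:
  fixes h :: "complex ^ 'n \<Rightarrow> complex"
  assumes h: "(h has_derivative D) (at (z + \<zeta> *s v))" and D: "\<And>c v. D (c *s v) = c * D v"
  shows "((\<lambda>\<zeta>. h (z + \<zeta> *s v)) has_field_derivative D v) (at \<zeta>)"
proof -
  have "linear (\<lambda>c. c *s v)"
    by (rule linearI) (simp_all add: vec_eq_iff algebra_simps)
  then have "((\<lambda>c. c *s v) has_derivative (\<lambda>c. c *s v)) (at \<zeta>)"
    by (intro bounded_linear_imp_has_derivative) (simp add: linear_conv_bounded_linear)
  then have "((\<lambda>c. z + c *s v) has_derivative (\<lambda>c. c *s v)) (at \<zeta>)"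
    by (auto intro!: derivative_eq_intros)
  from has_derivative_compose[OF this h]
  have "((\<lambda>\<zeta>. h (z + \<zeta> *s v)) has_derivative (\<lambda>c. c * D v)) (at \<zeta>)"
    by (simp add: D)
  moreover have "(\<lambda>c. c * D v) = (*) (D v)"
    by (simp add: fun_eq_iff)
  ultimately show ?thesis
    by (simp add: has_field_derivative_def)
qed

lemma slice_holomorphic:
  fixes h :: "complex ^ 'n \<Rightarrow> complex"
  assumes h: "holomorphic_vec_on h G" and sub: "\<And>\<zeta>. \<zeta> \<in> S \<Longrightarrow> z + \<zeta> *s v \<in> G" and "open S"
  shows "(\<lambda>\<zeta>. h (z + \<zeta> *s v)) holomorphic_on S"
proof -
  have "\<exists>c. ((\<lambda>\<zeta>. h (z + \<zeta> *s v)) has_field_derivative c) (at \<zeta>)" if \<zeta>: "\<zeta> \<in> S" for \<zeta>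
  proof -
    obtain D where "(h has_derivative D) (at (z + \<zeta> *s v))" "\<forall>c v. D (c *s v) = c * D v"
      using h sub[OF \<zeta>] unfolding holomorphic_vec_on_def by blast
    then show ?thesis
      using slice_has_field_derivative by blast
  qed
  then show ?thesis
    using \<open>open S\<close> by (simp add: holomorphic_on_open)
qed

lemma norm_vector_scalar_mult:
  fixes v :: "complex ^ 'n"
  shows "norm (c *s v) = norm c * norm v"
  by (simp add: norm_vec_def norm_mult L2_set_right_distrib)

text \<open>The planar estimate on the slice of radius \<open>r\<close> through \<open>z\<close> in each direction \<open>\<theta>\<close>; the
  anti-holomorphic part of the derivative is at most the holomorphic part, whence the second
  factor two in the constant.\<close>

lemma Hk_derivative_bound:
  fixes f :: "complex ^ 'n \<Rightarrow> complex"
  assumes f: "f \<in> Hk k G" and "0 < k" "k < 1" and "open G" and "0 < r" and sub: "ball z r \<subseteq> G"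
    and bound: "\<And>w. w \<in> ball z r \<Longrightarrow> norm (f w) \<le> M"
  obtains f' where "(f has_derivative f') (at z)"
    and "onorm f' \<le> 4 / (1 - k) * ((M - norm (f z)) / r)"
proof -
  obtain h g where h: "holomorphic_vec_on h G" and g: "holomorphic_vec_on g G"
    and fhg: "\<And>w. w \<in> G \<Longrightarrow> f w = h w + cnj (g w)"
    and dil: "\<And>\<theta> w. norm \<theta> = 1 \<Longrightarrow> w \<in> G \<Longrightarrow>
          norm (hdot (grad_zbar f w) \<theta>) \<le> k * norm (hdot (grad_z f w) (vcnj \<theta>))"
    using f unfolding Hk_def by blast
  have z: "z \<in> G"
    using sub \<open>0 < r\<close> by auto
  obtain A where A: "(h has_derivative A) (at z)" "\<And>c v. A (c *s v) = c * A v"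
    using h z unfolding holomorphic_vec_on_def by blast
  obtain B where B: "(g has_derivative B) (at z)" "\<And>c v. B (c *s v) = c * B v"
    using g z unfolding holomorphic_vec_on_def by blast
  define f' where "f' = (\<lambda>v. A v + cnj (B v))"
  have lin: "linear A" "linear B"
    using A(1) B(1) by (auto dest: has_derivative_linear)
  have "((\<lambda>w. h w + cnj (g w)) has_derivative f') (at z)"
    unfolding f'_def by (intro has_derivative_add has_derivative_cnj A(1) B(1))
  then have f': "(f has_derivative f') (at z)"
    by (rule has_derivative_transform_within_open[OF _ \<open>open G\<close> z]) (simp add: fhg)
  have unit: "norm (f' \<theta>) \<le> 4 / (1 - k) * ((M - norm (f z)) / r)" if \<theta>: "norm \<theta> = 1" for \<theta>
  proof -
    have BA: "norm (B \<theta>) \<le> k * norm (A \<theta>)"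
      using dil[OF \<theta> z] hdot_gradients[OF f'[unfolded f'_def] lin(1) A(2) lin(2) B(2), of \<theta>]
      by simp
    define v where "v = complex_of_real r *s \<theta>"
    have in_ball: "z + \<zeta> *s v \<in> ball z r" if "norm \<zeta> < 1" for \<zeta>
      using that \<theta> \<open>0 < r\<close> by (simp add: v_def dist_norm norm_vector_scalar_mult norm_mult)
    have hol: "(\<lambda>\<zeta>. h (z + \<zeta> *s v)) holomorphic_on ball 0 1"
              "(\<lambda>\<zeta>. g (z + \<zeta> *s v)) holomorphic_on ball 0 1"
    proof -
      have "z + \<zeta> *s v \<in> G" if "\<zeta> \<in> ball 0 1" for \<zeta>
        using in_ball[of \<zeta>] that sub by auto
      then show "(\<lambda>\<zeta>. h (z + \<zeta> *s v)) holomorphic_on ball 0 1"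
                "(\<lambda>\<zeta>. g (z + \<zeta> *s v)) holomorphic_on ball 0 1"
        using slice_holomorphic[OF h _ open_ball] slice_holomorphic[OF g _ open_ball] by blast+
    qed
    have der: "deriv (\<lambda>\<zeta>. h (z + \<zeta> *s v)) 0 = of_real r * A \<theta>"
              "deriv (\<lambda>\<zeta>. g (z + \<zeta> *s v)) 0 = of_real r * B \<theta>"
      using slice_has_field_derivative[of h A z 0 v] slice_has_field_derivative[of g B z 0 v] A B
      by (auto intro!: DERIV_imp_deriv simp: v_def)
    have "(1 - k) * norm (deriv (\<lambda>\<zeta>. h (z + \<zeta> *s v)) 0)
        \<le> 2 * (M - norm (h (z + 0 *s v) + cnj (g (z + 0 *s v))))"
    proof (rule harmonic_quasiregular_deriv_bound[OF hol])
      show "norm (deriv (\<lambda>\<zeta>. g (z + \<zeta> *s v)) 0) \<le> k * norm (deriv (\<lambda>\<zeta>. h (z + \<zeta> *s v)) 0)"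
        using BA \<open>0 < r\<close> by (simp add: der norm_mult)
      show "norm (h (z + \<zeta> *s v) + cnj (g (z + \<zeta> *s v))) \<le> M" if "norm \<zeta> < 1" for \<zeta>
        using bound[OF in_ball[OF that]] fhg[of "z + \<zeta> *s v"] sub in_ball[OF that]
        by (auto simp: subset_iff)
    qed
    then have "(1 - k) * (r * norm (A \<theta>)) \<le> 2 * (M - norm (f z))"
      using \<open>0 < r\<close> fhg[OF z] by (simp add: der norm_mult)
    then have "norm (A \<theta>) \<le> 2 / (1 - k) * ((M - norm (f z)) / r)"
      using \<open>0 < r\<close> \<open>k < 1\<close> by (simp add: field_simps)
    moreover have "norm (f' \<theta>) \<le> 2 * norm (A \<theta>)"
    proof -
      have "norm (f' \<theta>) \<le> norm (A \<theta>) + norm (B \<theta>)"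
        unfolding f'_def using norm_triangle_ineq[of "A \<theta>" "cnj (B \<theta>)"] by simp
      moreover have "k * norm (A \<theta>) \<le> norm (A \<theta>)"
        using \<open>k < 1\<close> \<open>0 < k\<close> by (simp add: mult_left_le_one_le)
      ultimately show ?thesis
        using BA by linarith
    qed
    ultimately have "norm (f' \<theta>) \<le> 2 * (2 / (1 - k) * ((M - norm (f z)) / r))"
      by linarith
    then show ?thesis
      by simp
  qed
  have "onorm f' \<le> 4 / (1 - k) * ((M - norm (f z)) / r)"
  proof (rule onorm_le)
    fix v :: "complex ^ 'n"
    have lin': "linear f'"
      using f' by (rule has_derivative_linear)
    show "norm (f' v) \<le> 4 / (1 - k) * ((M - norm (f z)) / r) * norm v"
    proof (cases "v = 0")
      case True
      then show ?thesis
        using linear_0[OF lin'] by simp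
    next
      case False
      have "norm (f' v) / norm v = norm (f' (v /\<^sub>R norm v))"
        by (simp add: linear_scale[OF lin'] divide_inverse)
      also have "\<dots> \<le> 4 / (1 - k) * ((M - norm (f z)) / r)"
        using False by (intro unit) simp
      finally show ?thesis
        using False by (simp add: pos_divide_le_eq)
    qed
  qed
  with f' show thesis
    by (rule that)
qed

section \<open>Boundary distance and majorants\<close>

lemma proper_domain_frontier_nonempty:
  assumes "proper_domain G"
  shows "frontier G \<noteq> {}"
  using assms frontier_eq_empty[of G] by (auto simp: proper_domain_def domain_def)

lemma bdist_pos:
  assumes "proper_domain G" "z \<in> G"
  shows "0 < bdist G z"
  unfolding bdist_def
proof (rule infdist_pos_not_in_closed)
  show "z \<notin> frontier G"
    using assms by (auto simp: proper_domain_def domain_def frontier_def interior_open)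
qed (use proper_domain_frontier_nonempty[OF assms(1)] in auto)

lemma ball_bdist_subset:
  assumes "proper_domain G" "z \<in> G"
  shows "ball z (bdist G z) \<subseteq> G"
proof (rule ccontr)
  assume "\<not> ball z (bdist G z) \<subseteq> G"
  moreover have "ball z (bdist G z) \<inter> G \<noteq> {}"
    using assms(2) bdist_pos[OF assms] centre_in_ball by blast
  ultimately have "ball z (bdist G z) \<inter> frontier G \<noteq> {}"
    by (intro connected_Int_frontier) auto
  then obtain w where "w \<in> frontier G" "dist z w < bdist G z"
    by auto
  then show False
    unfolding bdist_def using infdist_le[of w "frontier G" z] by linarith
qed

lemma bdist_attained:
  assumes "proper_domain G"
  obtains w where "w \<in> frontier G" "dist z w = bdist G z"
proof -
  obtain w where "w \<in> frontier G" "infdist z (frontier G) = dist z w"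
    using infdist_attains_inf[OF frontier_closed proper_domain_frontier_nonempty[OF assms]] .
  then show thesis
    by (intro that) (simp_all add: bdist_def)
qed

lemma majorant_mono: "majorant \<omega> \<Longrightarrow> 0 \<le> s \<Longrightarrow> s \<le> t \<Longrightarrow> \<omega> s \<le> \<omega> t"
  unfolding majorant_def monotone_on_def by auto

lemma majorant_quotient_antimono:
  "majorant \<omega> \<Longrightarrow> 0 < s \<Longrightarrow> s \<le> t \<Longrightarrow> \<omega> t / t \<le> \<omega> s / s"
  unfolding majorant_def monotone_on_def by auto

section \<open>Lipschitz conditions\<close>

text \<open>If \<open>|z - w|\<close> is less than half the distance from \<open>z\<close> to the boundary, then every point of the
  segment from \<open>z\<close> to \<open>w\<close> is farther than \<open>|z - w|\<close> from the boundary, so monotonicity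
  of \<open>\<omega>(t) / t\<close> bounds the derivative on it by a multiple of
  \<open>\<omega>(|z - w|) / |z - w|\<close>.\<close>

lemma loc_Lip_if_derivative_bound:
  fixes f :: "complex ^ 'n \<Rightarrow> complex"
  assumes \<omega>: "majorant \<omega>" and G: "proper_domain G" and "0 < C"
    and der: "\<And>z. z \<in> G \<Longrightarrow>
        \<exists>f'. (f has_derivative f') (at z) \<and> onorm f' \<le> C * (\<omega> (bdist G z) / bdist G z)"
  shows "f \<in> loc_Lip \<omega> G"
proof -
  obtain f' where f': "\<And>z. z \<in> G \<Longrightarrow> (f has_derivative f' z) (at z)"
    and f'_le: "\<And>z. z \<in> G \<Longrightarrow> onorm (f' z) \<le> C * (\<omega> (bdist G z) / bdist G z)"
    using der by metis
  have "norm (f z - f w) \<le> C * \<omega> (norm (z - w))"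
    if z: "z \<in> G" and close: "norm (z - w) < bdist G z / 2" for z w
  proof (cases "z = w")
    case True
    then show ?thesis
      using \<omega> by (simp add: majorant_def)
  next
    case False
    define \<delta> where "\<delta> = norm (z - w)"
    have \<delta>: "0 < \<delta>" "\<delta> < bdist G z / 2"
      using False close by (simp_all add: \<delta>_def)
    have seg: "x \<in> G \<and> onorm (f' x) \<le> C * (\<omega> \<delta> / \<delta>)" if x: "x \<in> closed_segment z w" for x
    proof -
      have zx: "dist z x \<le> \<delta>"
        using segment_bound1[OF x] by (simp add: \<delta>_def dist_norm norm_minus_commute)
      then have "x \<in> ball z (bdist G z)"
        using \<delta> by simp
      then have xG: "x \<in> G"
        using ball_bdist_subset[OF G z] by blast
      have "bdist G z \<le> bdist G x + dist z x"
        unfolding bdist_def by (rule infdist_triangle)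
      then have "\<delta> \<le> bdist G x"
        using zx \<delta> by linarith
      then have "\<omega> (bdist G x) / bdist G x \<le> \<omega> \<delta> / \<delta>"
        using majorant_quotient_antimono[OF \<omega> \<delta>(1)] by blast
      then have "C * (\<omega> (bdist G x) / bdist G x) \<le> C * (\<omega> \<delta> / \<delta>)"
        using \<open>0 < C\<close> by (intro mult_left_mono) auto
      then show ?thesis
        using f'_le[OF xG] xG by linarith
    qed
    have "norm (f z - f w) \<le> C * (\<omega> \<delta> / \<delta>) * norm (z - w)"
    proof (rule differentiable_bound[where S = "closed_segment z w" and f' = f'])
      show "(f has_derivative f' x) (at x within closed_segment z w)"
        if "x \<in> closed_segment z w" for x
        using f' seg[OF that] by (blast intro: has_derivative_at_withinI)
    qed (use seg in auto)
    then show ?thesis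
      using \<delta>(1) by (simp add: \<delta>_def)
  qed
  then show ?thesis
    unfolding loc_Lip_def using \<open>0 < C\<close> by blast
qed

lemma norm_in_Lip:
  assumes "f \<in> Lip \<omega> G"
  shows "(\<lambda>z. complex_of_real (norm (f z))) \<in> Lip \<omega> G"
proof -
  obtain C where "0 < C" and C: "\<And>z w. z \<in> G \<Longrightarrow> w \<in> G \<Longrightarrow> norm (f z - f w) \<le> C * \<omega> (norm (z - w))"
    using assms unfolding Lip_def by blast
  have "norm (complex_of_real (norm (f z)) - complex_of_real (norm (f w))) \<le> norm (f z - f w)" for z w
    by (metis norm_of_real norm_triangle_ineq3 of_real_diff)
  then show ?thesis
    unfolding Lip_def using \<open>0 < C\<close> C by (blast intro: order_trans)
qed

lemma Lip_imp_bdry_Lip: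
  fixes u :: "complex ^ 'n \<Rightarrow> complex"
  assumes \<omega>: "majorant \<omega>" and cont: "continuous_on (G \<union> frontier G) u" and u: "u \<in> Lip \<omega> G"
  shows "u \<in> bdry_Lip \<omega> G"
proof -
  obtain C where "0 < C" and C: "\<And>z w. z \<in> G \<Longrightarrow> w \<in> G \<Longrightarrow> norm (u z - u w) \<le> C * \<omega> (norm (z - w))"
    using u unfolding Lip_def by blast
  have "norm (u z - u w) \<le> C * \<omega> (norm (z - w))" if z: "z \<in> G" and w: "w \<in> frontier G" for z w
  proof -
    have "w \<in> closure G"
      using w by (simp add: frontier_def)
    then obtain x where x: "\<And>n. x n \<in> G" "x \<longlonglongrightarrow> w"
      unfolding closure_sequential by blast
    have "(\<lambda>n. u (x n)) \<longlonglongrightarrow> u w"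
      using x w by (intro continuous_on_tendsto_compose[OF cont]) auto
    then have "(\<lambda>n. norm (u z - u (x n))) \<longlonglongrightarrow> norm (u z - u w)"
      by (intro tendsto_intros)
    moreover have "(\<lambda>n. \<omega> (norm (z - x n))) \<longlonglongrightarrow> \<omega> (norm (z - w))"
    proof -
      have "continuous_on {0..} \<omega>"
        using \<omega> by (simp add: majorant_def)
      moreover have "(\<lambda>n. norm (z - x n)) \<longlonglongrightarrow> norm (z - w)"
        using x(2) by (intro tendsto_intros)
      ultimately show ?thesis
        by (rule continuous_on_tendsto_compose) auto
    qed
    then have "(\<lambda>n. C * \<omega> (norm (z - x n))) \<longlonglongrightarrow> C * \<omega> (norm (z - w))"
      by (intro tendsto_intros)
    ultimately show ?thesis
      using C z x by (intro LIMSEQ_le) auto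
  qed
  then show ?thesis
    unfolding bdry_Lip_def using \<open>0 < C\<close> cont by blast
qed

text \<open>Both \<open>z\<close> and any \<open>w\<close> in the ball of radius \<open>d\<close> about \<open>z\<close> are compared with the same nearest
  boundary point \<open>\<zeta>\<close> of \<open>z\<close>.  The two steps cost \<open>C \<omega>(d)\<close> and \<open>C \<omega>(2 d) \<le> 2 C \<omega>(d)\<close>.\<close>

lemma norm_growth_if_bdry_Lip:
  fixes f :: "complex ^ 'n \<Rightarrow> complex"
  assumes \<omega>: "majorant \<omega>" and G: "proper_domain G" and "0 < C"
    and C: "\<And>z w. z \<in> G \<Longrightarrow> w \<in> frontier G \<Longrightarrow> \<bar>norm (f z) - norm (f w)\<bar> \<le> C * \<omega> (norm (z - w))"
    and z: "z \<in> G" and w: "w \<in> ball z (bdist G z)"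
  shows "norm (f w) \<le> norm (f z) + 3 * C * \<omega> (bdist G z)"
proof -
  define d where "d = bdist G z"
  have d: "0 < d"
    using bdist_pos[OF G z] by (simp add: d_def)
  obtain \<zeta> where \<zeta>: "\<zeta> \<in> frontier G" "dist z \<zeta> = d"
    using bdist_attained[OF G] unfolding d_def by blast
  have wG: "w \<in> G"
    using ball_bdist_subset[OF G z] w by blast
  have "norm (w - \<zeta>) \<le> 2 * d"
    using dist_triangle[of w \<zeta> z] w \<zeta>(2) by (simp add: d_def dist_norm norm_minus_commute)
  then have "\<omega> (norm (w - \<zeta>)) \<le> \<omega> (2 * d)"
    by (intro majorant_mono[OF \<omega>]) auto
  also have "\<dots> \<le> 2 * \<omega> d"
    using majorant_quotient_antimono[OF \<omega> d, of "2 * d"] d by (simp add: field_simps)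
  finally have "C * \<omega> (norm (w - \<zeta>)) \<le> C * (2 * \<omega> d)"
    using \<open>0 < C\<close> by (intro mult_left_mono) auto
  moreover have "\<bar>norm (f z) - norm (f \<zeta>)\<bar> \<le> C * \<omega> d"
    using C[OF z \<zeta>(1)] \<zeta>(2) by (simp add: dist_norm)
  ultimately show ?thesis
    using C[OF wG \<zeta>(1)] by (fold d_def) linarith
qed

theorem theorem2:
  fixes \<omega> :: "real \<Rightarrow> real" and G :: "(complex ^ 'n) set"
    and f :: "complex ^ 'n \<Rightarrow> complex" and k :: real
  assumes "majorant \<omega>"
    and "\<exists>\<delta>\<^sub>0>0. \<exists>C>0. \<forall>\<delta>. 0 < \<delta> \<and> \<delta> < \<delta>\<^sub>0 \<longrightarrow>
           (\<lambda>t. \<omega> t / t) integrable_on {0..\<delta>} \<and> integral {0..\<delta>} (\<lambda>t. \<omega> t / t) \<le> C * \<omega> \<delta>"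
    and "extension_domain \<omega> G"
    and "0 < k" and "k < 1"
    and "f \<in> Hk k G"
    and "continuous_on (G \<union> frontier G) f"
  shows "(f \<in> Lip \<omega> G \<longleftrightarrow> (\<lambda>z. complex_of_real (norm (f z))) \<in> Lip \<omega> G) \<and>
         ((\<lambda>z. complex_of_real (norm (f z))) \<in> Lip \<omega> G \<longleftrightarrow>
          (\<lambda>z. complex_of_real (norm (f z))) \<in> bdry_Lip \<omega> G)"
proof -
  let ?u = "\<lambda>z. complex_of_real (norm (f z))"
  have G: "proper_domain G" and ext: "Lip \<omega> G = loc_Lip \<omega> G"
    using assms(3) by (auto simp: extension_domain_def)
  have "open G"
    using G by (simp add: proper_domain_def domain_def)
  have "continuous_on (G \<union> frontier G) ?u"
    using assms(7) by (intro continuous_intros)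
  then have to_boundary: "?u \<in> bdry_Lip \<omega> G" if "?u \<in> Lip \<omega> G"
    using Lip_imp_bdry_Lip[OF assms(1)] that by blast
  have from_boundary: "f \<in> Lip \<omega> G" if u: "?u \<in> bdry_Lip \<omega> G"
  proof -
    obtain C where "0 < C" and "\<And>z w. z \<in> G \<Longrightarrow> w \<in> frontier G \<Longrightarrow>
        norm (?u z - ?u w) \<le> C * \<omega> (norm (z - w))"
      using u unfolding bdry_Lip_def by blast
    then have C: "\<And>z w. z \<in> G \<Longrightarrow> w \<in> frontier G \<Longrightarrow>
        \<bar>norm (f z) - norm (f w)\<bar> \<le> C * \<omega> (norm (z - w))"
      by (metis norm_of_real of_real_diff)
    have "\<exists>f'. (f has_derivative f') (at z) \<and>
        onorm f' \<le> 12 * C / (1 - k) * (\<omega> (bdist G z) / bdist G z)" if z: "z \<in> G" for z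
    proof -
      have "norm (f w) \<le> norm (f z) + 3 * C * \<omega> (bdist G z)" if "w \<in> ball z (bdist G z)" for w
        by (rule norm_growth_if_bdry_Lip[OF assms(1) G \<open>0 < C\<close> C z that])
      then obtain f' where "(f has_derivative f') (at z)"
        and "onorm f' \<le> 4 / (1 - k) *
          ((norm (f z) + 3 * C * \<omega> (bdist G z) - norm (f z)) / bdist G z)"
        by (rule Hk_derivative_bound[OF assms(6,4,5) \<open>open G\<close> bdist_pos[OF G z]
            ball_bdist_subset[OF G z]])
      then show ?thesis
        by (intro exI[of _ f']) simp
    qed
    then have "f \<in> loc_Lip \<omega> G"
      using \<open>0 < C\<close> assms(5) by (intro loc_Lip_if_derivative_bound[OF assms(1) G, of "12 * C / (1 - k)"]) auto
    then show ?thesis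
      by (simp add: ext)
  qed
  show ?thesis
    using norm_in_Lip to_boundary from_boundary by blast
qed

end
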